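(* Let $D$ be the formal derivative associated with the grammar $G=\{u\rightarrow u^2v,\ v\rightarrow u^3\}$. Then for every integer $n\ge0$, $$D^n(uv)=n!\sum_{k=0}^{\lfloor (n+1)/2\rfloor}\binom{n+1}{2k}u^{n+1+2k}v^{n+1-2k},$$ $$D^n(u^2)=n!\sum_{k=0}^{\lfloor n/2\rfloor}\binom{n+1}{2k+1}u^{n+2+2k}v^{n-2k}.$$ In particular, $$D^n(uv)\big|_{u^2=x^2-1,\,v=x}=n!\,(x^2-1)^{\frac{n+1}2}T_{n+1}(x),$$ $$D^n(u^2)\big|_{u^2=x^2-1,\,v=x}=n!\,(x^2-1)^{\frac{n+2}2}U_n(x),$$ where $T_n$ and $U_n$ are the Chebyshev polynomials of the first and second kind of order $n$.
   Context: For a grammar $G$ over a set of independent commuting indeterminates, the formal derivative $D$ is the linear derivation (satisfying the Leibniz rule) on polynomials in these indeterminates sending each indeterminate to its image under the substitution rule; here $D$ is the derivation of $\mathbb{Q}[u,v]$ with $D(u)=u^2v$ and $D(v)=u^3$. The substitution $u^2=x^2-1$, $v=x$ means $u$ is replaced by a fixed square root $(x^2-1)^{1/2}$ and $v$ by $x$, with $(x^2-1)^{m/2}$ denoting the $m$-th power of that same square root. *)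

theory Defs
  imports Complex_Main "HOL-Computational_Algebra.Polynomial"
begin

(* The ring Q[u,v] is represented as Q[v][u]: the outer indeterminate is u, the
   indeterminate of the coefficient ring is v. *)

type_synonym poly_uv = "rat poly poly"

definition var_u :: poly_uv where "var_u = [:0, 1:]"

definition var_v :: poly_uv where "var_v = [:[:0, 1:]:]"

definition const_uv :: "rat \<Rightarrow> poly_uv" where "const_uv c = [:[:c:]:]"

definition derivation_uv :: "(poly_uv \<Rightarrow> poly_uv) \<Rightarrow> bool" where
  "derivation_uv D \<longleftrightarrow>
     (\<forall>p q. D (p + q) = D p + D q) \<and>
     (\<forall>c p. D (const_uv c * p) = const_uv c * D p) \<and>
     (\<forall>p q. D (p * q) = D p * q + p * D q)"

(* formal_derivative a b D: D is the formal derivative of the grammar {u -> a, v -> b}.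
   Existence and uniqueness of D are ex1_formal_derivative below. *)

definition formal_derivative :: "poly_uv \<Rightarrow> poly_uv \<Rightarrow> (poly_uv \<Rightarrow> poly_uv) \<Rightarrow> bool" where
  "formal_derivative a b D \<longleftrightarrow> derivation_uv D \<and> D var_u = a \<and> D var_v = b"

(* The value of p under u := s, v := x. *)

definition subst_uv :: "'a \<Rightarrow> 'a \<Rightarrow> poly_uv \<Rightarrow> 'a::field_char_0" where
  "subst_uv s x p = poly (map_poly (\<lambda>c. poly (map_poly of_rat c) x) p) s"

fun chebyshev_T :: "nat \<Rightarrow> 'a::comm_ring_1 poly" where
  "chebyshev_T 0 = 1"
| "chebyshev_T (Suc 0) = [:0, 1:]"
| "chebyshev_T (Suc (Suc n)) = [:0, 2:] * chebyshev_T (Suc n) - chebyshev_T n"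

fun chebyshev_U :: "nat \<Rightarrow> 'a::comm_ring_1 poly" where
  "chebyshev_U 0 = 1"
| "chebyshev_U (Suc 0) = [:0, 2:]"
| "chebyshev_U (Suc (Suc n)) = [:0, 2:] * chebyshev_U (Suc n) - chebyshev_U n"

lemma chebyshev_T_cos: "poly (chebyshev_T n) (cos t) = cos (real n * t)"
proof (induction n rule: chebyshev_T.induct)
  case (3 n)
  have "cos (real (Suc (Suc n)) * t) + cos (real n * t) = 2 * cos t * cos (real (Suc n) * t)"
    using cos_add[of "real (Suc n) * t" t] cos_diff[of "real (Suc n) * t" t]
    by (simp add: algebra_simps)
  then show ?case using 3 by (simp add: algebra_simps)
qed simp_all

lemma chebyshev_U_sin: "poly (chebyshev_U n) (cos t) * sin t = sin (real (n + 1) * t)"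
proof (induction n rule: chebyshev_U.induct)
  case (2)
  then show ?case using sin_double[of t] by (simp add: algebra_simps)
next
  case (3 n)
  have "sin (real (n + 3) * t) + sin (real (n + 1) * t) = 2 * cos t * sin (real (n + 2) * t)"
    using sin_add[of "real (n + 2) * t" t] sin_diff[of "real (n + 2) * t" t]
    by (simp add: algebra_simps)
  then show ?case using 3 by (simp add: algebra_simps)
qed simp_all

lemma derivation_uv_const:
  assumes "derivation_uv D" shows "D (const_uv c) = 0"
proof -
  have "D (1 * 1) = D 1 * 1 + 1 * D 1" using assms unfolding derivation_uv_def by blast
  then have "D 1 = 0" by simp
  moreover have "D (const_uv c * 1) = const_uv c * D 1"
    using assms unfolding derivation_uv_def by blast
  ultimately show ?thesis by simp
qed

lemma formal_derivative_unique:
  assumes D: "formal_derivative a b D" and E: "formal_derivative a b E"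
  shows "D = E"
proof
  fix p :: poly_uv
  have D': "derivation_uv D" and E': "derivation_uv E"
    using D E by (auto simp: formal_derivative_def)
  have c: "D (const_uv r) = E (const_uv r)" for r
    by (simp add: derivation_uv_const[OF D'] derivation_uv_const[OF E'])
  have coeffs: "D [:q:] = E [:q:]" for q
  proof (induction q)
    case 0
    show ?case using c[of 0] by (simp add: const_uv_def)
  next
    case (pCons r q)
    have "[:pCons r q:] = const_uv r + var_v * [:q:]"
      by (simp add: const_uv_def var_v_def)
    moreover have "D (const_uv r + var_v * [:q:]) = E (const_uv r + var_v * [:q:])"
      using D E unfolding formal_derivative_def derivation_uv_def by (metis pCons.IH c)
    ultimately show ?case by metis
  qed
  show "D p = E p"
  proof (induction p)
    case 0
    show ?case using coeffs[of 0] by simp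
  next
    case (pCons q p)
    have "pCons q p = [:q:] + var_u * p" by (simp add: var_u_def)
    then show ?case using D E pCons coeffs[of q]
      by (simp add: formal_derivative_def derivation_uv_def)
  qed
qed

lemma ex1_formal_derivative: "\<exists>!D. formal_derivative a b D"
proof (rule ex_ex1I)
  define dv :: "poly_uv \<Rightarrow> poly_uv" where "dv = map_poly pderiv"
  have dv0 [simp]: "dv 0 = 0" by (simp add: dv_def)
  have dvC [simp]: "dv (pCons c p) = pCons (pderiv c) (dv p)" for c p
    unfolding dv_def by (simp add: map_poly_pCons)
  have dv1 [simp]: "dv 1 = 0" by (simp add: one_pCons)
  have dv_add: "dv (p + q) = dv p + dv q" for p q
    unfolding dv_def by (intro poly_eqI) (simp add: coeff_map_poly pderiv_add)
  have dv_smult: "dv (smult c p) = smult (pderiv c) p + smult c (dv p)" for c p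
    unfolding dv_def
    by (intro poly_eqI) (simp add: coeff_map_poly pderiv_mult algebra_simps)
  have dv_mult: "dv (p * q) = dv p * q + p * dv q" for p q
    by (induction p) (simp_all add: dv_add dv_smult algebra_simps)
  define D where "D p = a * pderiv p + b * dv p" for p
  have "derivation_uv D"
    unfolding derivation_uv_def D_def const_uv_def
    by (simp add: pderiv_add pderiv_mult pderiv_smult dv_add dv_mult dv_smult pderiv_pCons
        algebra_simps)
  moreover have "D var_u = a" "D var_v = b"
    by (simp_all add: D_def var_u_def var_v_def pderiv_pCons flip: one_pCons)
  ultimately show "\<exists>D. formal_derivative a b D" unfolding formal_derivative_def by blast
qed (rule formal_derivative_unique)

lemma map_poly_hom_mult:
  fixes h :: "'a::comm_ring_1 \<Rightarrow> 'b::comm_ring_1"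
  assumes [simp]: "h 0 = 0" and add: "\<And>x y. h (x + y) = h x + h y"
    and mult: "\<And>x y. h (x * y) = h x * h y"
  shows "map_poly h (p + q) = map_poly h p + map_poly h q"
    and "map_poly h (p * q) = map_poly h p * map_poly h q"
proof -
  have A: "map_poly h (p + q) = map_poly h p + map_poly h q" for p q
    by (intro poly_eqI) (simp add: coeff_map_poly add)
  have S: "map_poly h (smult c p) = smult (h c) (map_poly h p)" for c p
    by (intro poly_eqI) (simp add: coeff_map_poly mult)
  show "map_poly h (p + q) = map_poly h p + map_poly h q" by (rule A)
  show "map_poly h (p * q) = map_poly h p * map_poly h q"
    by (induction p) (simp_all add: A S map_poly_pCons)
qed

lemma subst_uv_simps:
  shows "subst_uv s x var_u = s" "subst_uv s x var_v = x" "subst_uv s x (const_uv c) = of_rat c"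
    and "subst_uv s x (p + q) = subst_uv s x p + subst_uv s x q"
    and "subst_uv s x (p * q) = subst_uv s x p * subst_uv s x q"
proof -
  have add: "map_poly of_rat (p + q) = (map_poly of_rat p + map_poly of_rat q :: 'a poly)"
    and mult: "map_poly of_rat (p * q) = (map_poly of_rat p * map_poly of_rat q :: 'a poly)" for p q
    by (simp_all add: map_poly_hom_mult of_rat_add of_rat_mult)
  show "subst_uv s x var_u = s" "subst_uv s x var_v = x" "subst_uv s x (const_uv c) = of_rat c"
    by (simp_all add: subst_uv_def var_u_def var_v_def const_uv_def map_poly_pCons)
  show "subst_uv s x (p + q) = subst_uv s x p + subst_uv s x q"
    "subst_uv s x (p * q) = subst_uv s x p * subst_uv s x q"
    unfolding subst_uv_def by (simp_all add: map_poly_hom_mult add mult)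
qed

end

theory Submission
  imports Defs
begin

text \<open>
  Put \<open>w\<^sub>+ = u (v + u)\<close> and \<open>w\<^sub>- = u (v - u)\<close>. Both satisfy \<open>D w = w\<^sup>2\<close>, so
  \<open>D\<^sup>n w = n! w\<^sup>n\<^sup>+\<^sup>1\<close>, while \<open>2uv = w\<^sub>+ + w\<^sub>-\<close> and \<open>2u\<^sup>2 = w\<^sub>+ - w\<^sub>-\<close>. The expansions are then
  the even and odd parts of the binomial theorem, and the Chebyshev polynomials enter through
  \<open>(x + s)\<^sup>n + (x - s)\<^sup>n = 2 T\<^sub>n(x)\<close> and \<open>(x + s)\<^sup>n\<^sup>+\<^sup>1 - (x - s)\<^sup>n\<^sup>+\<^sup>1 = 2 s U\<^sub>n(x)\<close>
  for \<open>s\<^sup>2 = x\<^sup>2 - 1\<close>.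
\<close>

section \<open>Even and odd parts of the binomial theorem\<close>

lemma binomial_even_part:
  fixes u v :: "'a::comm_ring_1"
  shows "(v + u) ^ m + (v - u) ^ m =
    2 * (\<Sum>k = 0..m div 2. of_nat (m choose (2 * k)) * u ^ (2 * k) * v ^ (m - 2 * k))"
proof -
  have "(v + u) ^ m + (v - u) ^ m =
      (\<Sum>j\<le>m. of_nat (m choose j) * (u ^ j + (- u) ^ j) * v ^ (m - j))"
    using binomial_ring[of u v m] binomial_ring[of "- u" v m]
    by (simp add: algebra_simps sum.distrib)
  \<comment> \<open>For odd \<open>j\<close> the terms \<open>u ^ j\<close> and
    \<open>(- u) ^ j\<close> cancel; for even \<open>j\<close> they coincide, which gives the factor
    2.\<close>
  also have "\<dots> = (\<Sum>j\<in>{j. j \<le> m \<and> even j}. of_nat (m choose j) * (u ^ j + (- u) ^ j) * v ^ (m - j))"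
    by (rule sum.mono_neutral_right) auto
  also have "\<dots> = (\<Sum>k = 0..m div 2. 2 * (of_nat (m choose (2 * k)) * u ^ (2 * k) * v ^ (m - 2 * k)))"
    by (rule sum.reindex_bij_witness[of _ "\<lambda>k. 2 * k" "\<lambda>j. j div 2"]) (auto simp: algebra_simps)
  finally show ?thesis by (simp add: sum_distrib_left)
qed

lemma binomial_odd_part:
  fixes u v :: "'a::comm_ring_1"
  shows "(v + u) ^ (n + 1) - (v - u) ^ (n + 1) =
    2 * (\<Sum>k = 0..n div 2. of_nat ((n + 1) choose (2 * k + 1)) * u ^ (2 * k + 1) * v ^ (n - 2 * k))"
proof -
  have "(v + u) ^ (n + 1) - (v - u) ^ (n + 1) =
      (\<Sum>j\<le>n + 1. of_nat ((n + 1) choose j) * (u ^ j - (- u) ^ j) * v ^ (n + 1 - j))"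
    using binomial_ring[of u v "n + 1"] binomial_ring[of "- u" v "n + 1"]
    by (simp add: algebra_simps sum_subtractf del: sum.atMost_Suc power_Suc binomial_Suc_Suc)
  also have "\<dots> = (\<Sum>j\<in>{j. j \<le> n + 1 \<and> odd j}.
      of_nat ((n + 1) choose j) * (u ^ j - (- u) ^ j) * v ^ (n + 1 - j))"
    by (rule sum.mono_neutral_right) auto
  \<comment> \<open>With \<open>j = 2 * k + 1\<close>, the bound \<open>j \<le> n + 1\<close>
    becomes \<open>k \<le> n div 2\<close> and the exponent \<open>n + 1 - j\<close> becomes
    \<open>n - 2 * k\<close>.\<close>
  also have "\<dots> = (\<Sum>k = 0..n div 2.
      2 * (of_nat ((n + 1) choose (2 * k + 1)) * u ^ (2 * k + 1) * v ^ (n - 2 * k)))"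
    by (rule sum.reindex_bij_witness[of _ "\<lambda>k. 2 * k + 1" "\<lambda>j. j div 2"])
      (auto simp: algebra_simps elim!: oddE simp del: binomial_Suc_Suc)
  finally show ?thesis by (simp only: sum_distrib_left)
qed

section \<open>Chebyshev polynomials through powers of \<open>x + s\<close> and
  \<open>x - s\<close>\<close>

lemma power_root_recurrence:
  fixes x s :: "'a::comm_ring_1"
  assumes "s ^ 2 = x ^ 2 - 1"
  shows "(x + s) ^ Suc (Suc n) = 2 * x * (x + s) ^ Suc n - (x + s) ^ n"
    and "(x - s) ^ Suc (Suc n) = 2 * x * (x - s) ^ Suc n - (x - s) ^ n"
proof -
  \<comment> \<open>The two elements have sum \<open>2 * x\<close> and product
    \<open>x ^ 2 - s ^ 2 = 1\<close>, so both are roots of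
    \<open>t ^ 2 - 2 * x * t + 1\<close>.\<close>
  have "(x + s) ^ 2 = 2 * x * (x + s) - 1" "(x - s) ^ 2 = 2 * x * (x - s) - 1"
    using assms by (simp_all add: power2_eq_square algebra_simps)
  then have "(x + s) ^ Suc (Suc n) = (2 * x * (x + s) - 1) * (x + s) ^ n"
      "(x - s) ^ Suc (Suc n) = (2 * x * (x - s) - 1) * (x - s) ^ n"
    by (simp_all add: power2_eq_square mult.assoc [symmetric])
  then show "(x + s) ^ Suc (Suc n) = 2 * x * (x + s) ^ Suc n - (x + s) ^ n"
    "(x - s) ^ Suc (Suc n) = 2 * x * (x - s) ^ Suc n - (x - s) ^ n"
    by (simp_all add: left_diff_distrib mult.assoc)
qed

text \<open>Both sides obey the same second-order recurrence and start with 2 and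
  \<open>2 * x\<close>.\<close>

lemma chebyshev_T_power_sum:
  fixes x s :: "'a::comm_ring_1"
  assumes "s ^ 2 = x ^ 2 - 1"
  shows "(x + s) ^ n + (x - s) ^ n = 2 * poly (chebyshev_T n) x"
proof (induction n rule: chebyshev_T.induct)
  case (3 n)
  have "(x + s) ^ Suc (Suc n) + (x - s) ^ Suc (Suc n) =
      2 * x * ((x + s) ^ Suc n + (x - s) ^ Suc n) - ((x + s) ^ n + (x - s) ^ n)"
    unfolding power_root_recurrence[OF assms] by (simp only: distrib_left) simp
  then show ?case unfolding 3 by (simp add: algebra_simps)
qed simp_all

text \<open>Same recurrence, now with initial values \<open>2 * s\<close> and
  \<open>4 * x * s\<close>. Keeping \<open>s\<close> as a factor avoids division, so
  \<open>s = 0\<close> is covered.\<close>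

lemma chebyshev_U_power_diff:
  fixes x s :: "'a::comm_ring_1"
  assumes "s ^ 2 = x ^ 2 - 1"
  shows "(x + s) ^ (n + 1) - (x - s) ^ (n + 1) = 2 * s * poly (chebyshev_U n) x"
proof (induction n rule: chebyshev_U.induct)
  case (3 n)
  have "(x + s) ^ (Suc (Suc n) + 1) - (x - s) ^ (Suc (Suc n) + 1) =
      2 * x * ((x + s) ^ (Suc n + 1) - (x - s) ^ (Suc n + 1)) - ((x + s) ^ (n + 1) - (x - s) ^ (n + 1))"
    using power_root_recurrence[OF assms, of "Suc n"]
    by (simp only: add_Suc Suc_eq_plus1[symmetric] right_diff_distrib) simp
  then show ?case unfolding 3 by (simp add: algebra_simps)
qed (simp_all add: power2_eq_square algebra_simps)

section \<open>Iterating a derivation\<close>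

context
  fixes D :: "poly_uv \<Rightarrow> poly_uv"
  assumes D: "derivation_uv D"
begin

lemma derivation_uv_add: "D (p + q) = D p + D q"
  and derivation_uv_mult: "D (p * q) = D p * q + p * D q"
  using D by (simp_all add: derivation_uv_def)

lemma derivation_uv_diff: "D (p - q) = D p - D q"
  using derivation_uv_add[of "p - q" q] by simp

lemma derivation_uv_of_nat_mult: "D (of_nat k * p) = of_nat k * D p"
proof (induction k)
  case 0
  show ?case using derivation_uv_add[of 0 0] by simp
qed (simp add: derivation_uv_add algebra_simps)

text \<open>The power rule \<open>(k + 1) * w ^ k * D w\<close> with \<open>D w = w ^ 2\<close>:
  each application of \<open>D\<close> raises the exponent by one and brings down the old
  exponent.\<close>

lemma derivation_uv_power_square:
  assumes "D w = w ^ 2"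
  shows "D (w ^ Suc k) = of_nat (Suc k) * w ^ Suc (Suc k)"
  by (induction k) (simp_all add: assms derivation_uv_mult power2_eq_square algebra_simps)

lemma derivation_uv_iterate_square:
  assumes "D w = w ^ 2"
  shows "(D ^^ n) w = fact n * w ^ (n + 1)"
proof (induction n)
  case (Suc n)
  \<comment> \<open>The factorial is read as a natural number cast into the ring, so that additivity
    alone moves it past \<open>D\<close>.\<close>
  have "(D ^^ Suc n) w = D (of_nat (fact n) * w ^ Suc n)"
    using Suc by simp
  also have "\<dots> = of_nat (fact n) * (of_nat (Suc n) * w ^ Suc (Suc n))"
    by (simp only: derivation_uv_of_nat_mult derivation_uv_power_square[OF assms])
  finally show ?case by (simp add: algebra_simps)
qed simp

lemma derivation_uv_iterate_add: "(D ^^ n) (p + q) = (D ^^ n) p + (D ^^ n) q"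
  by (induction n) (simp_all add: derivation_uv_add)

lemma derivation_uv_iterate_diff: "(D ^^ n) (p - q) = (D ^^ n) p - (D ^^ n) q"
  by (induction n) (simp_all add: derivation_uv_diff)

end

section \<open>The derivation of the grammar\<close>

context
  fixes D :: "poly_uv \<Rightarrow> poly_uv"
  assumes D: "formal_derivative (var_u ^ 2 * var_v) (var_u ^ 3) D"
begin

text \<open>Here \<open>D\<close> sends uv to \<open>u^2 v^2 + u^4\<close> and \<open>u^2\<close> to
  \<open>2 u^3 v\<close>; the sum and the difference of these images are the squares of u(v + u) and
  u(v - u).\<close>

lemma formal_derivative_iterate_factors:
  shows "(D ^^ n) (var_u * (var_v + var_u)) = fact n * (var_u * (var_v + var_u)) ^ (n + 1)"
    and "(D ^^ n) (var_u * (var_v - var_u)) = fact n * (var_u * (var_v - var_u)) ^ (n + 1)"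
proof -
  have d: "derivation_uv D" and uv: "D var_u = var_u ^ 2 * var_v" "D var_v = var_u ^ 3"
    using D by (simp_all add: formal_derivative_def)
  note rules = derivation_uv_mult[OF d] derivation_uv_add[OF d] derivation_uv_diff[OF d] uv
  show "(D ^^ n) (var_u * (var_v + var_u)) = fact n * (var_u * (var_v + var_u)) ^ (n + 1)"
    by (rule derivation_uv_iterate_square[OF d])
      (simp only: rules, simp add: power2_eq_square power3_eq_cube algebra_simps)
  show "(D ^^ n) (var_u * (var_v - var_u)) = fact n * (var_u * (var_v - var_u)) ^ (n + 1)"
    by (rule derivation_uv_iterate_square[OF d])
      (simp only: rules, simp add: power2_eq_square power3_eq_cube algebra_simps)
qed

text \<open>Stated for the double to avoid halves; this unexpanded form serves both the binomial
  expansion and the substitution.\<close>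

lemma formal_derivative_iterate_uv:
  "2 * (D ^^ n) (var_u * var_v) =
    fact n * var_u ^ (n + 1) * ((var_v + var_u) ^ (n + 1) + (var_v - var_u) ^ (n + 1))"
proof -
  have d: "derivation_uv D" using D by (simp add: formal_derivative_def)
  have "2 * (D ^^ n) (var_u * var_v) = (D ^^ n) (var_u * var_v + var_u * var_v)"
    by (simp only: derivation_uv_iterate_add[OF d] mult_2)
  also have "var_u * var_v + var_u * var_v = var_u * (var_v + var_u) + var_u * (var_v - var_u)"
    by (simp add: algebra_simps)
  finally show ?thesis
    unfolding derivation_uv_iterate_add[OF d] formal_derivative_iterate_factors power_mult_distrib
    by (simp only: distrib_left mult.assoc)
qed

lemma formal_derivative_iterate_u2:
  "2 * (D ^^ n) (var_u ^ 2) =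
    fact n * var_u ^ (n + 1) * ((var_v + var_u) ^ (n + 1) - (var_v - var_u) ^ (n + 1))"
proof -
  have d: "derivation_uv D" using D by (simp add: formal_derivative_def)
  have "2 * (D ^^ n) (var_u ^ 2) = (D ^^ n) (var_u ^ 2 + var_u ^ 2)"
    by (simp only: derivation_uv_iterate_add[OF d] mult_2)
  also have "var_u ^ 2 + var_u ^ 2 = var_u * (var_v + var_u) - var_u * (var_v - var_u)"
    by (simp add: power2_eq_square algebra_simps)
  finally show ?thesis
    unfolding derivation_uv_iterate_diff[OF d] formal_derivative_iterate_factors power_mult_distrib
    by (simp only: right_diff_distrib mult.assoc)
qed

end

section \<open>Substitution and conclusion\<close>

lemma subst_uv_diff: "subst_uv s x (p - q) = subst_uv s x p - subst_uv s x q"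
  using subst_uv_simps(4)[of s x "p - q" q] by simp

lemma subst_uv_of_nat: "subst_uv s x (of_nat k) = of_nat k"
proof -
  have "of_nat k = const_uv (of_nat k)"
    by (simp add: const_uv_def of_nat_poly)
  then show ?thesis by (simp add: subst_uv_simps)
qed

lemma subst_uv_power: "subst_uv s x (p ^ k) = subst_uv s x p ^ k"
  by (induction k) (use subst_uv_of_nat[of s x 1] in \<open>simp_all add: subst_uv_simps\<close>)

lemma subst_uv_fact: "subst_uv s x (fact n) = fact n"
  using subst_uv_of_nat[of s x "fact n"] by simp

lemma subst_uv_2: "subst_uv s x 2 = 2"
  using subst_uv_of_nat[of s x 2] by simp

theorem theorem9:
  fixes D :: "poly_uv \<Rightarrow> poly_uv" and n :: nat
  assumes "formal_derivative (var_u ^ 2 * var_v) (var_u ^ 3) D"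
  shows "(D ^^ n) (var_u * var_v) =
           fact n * (\<Sum>k = 0..(n + 1) div 2.
             of_nat ((n + 1) choose (2 * k)) * var_u ^ (n + 1 + 2 * k) * var_v ^ (n + 1 - 2 * k)) \<and>
         (D ^^ n) (var_u ^ 2) =
           fact n * (\<Sum>k = 0..n div 2.
             of_nat ((n + 1) choose (2 * k + 1)) * var_u ^ (n + 2 + 2 * k) * var_v ^ (n - 2 * k)) \<and>
         (\<forall>x s :: 'a::field_char_0. s ^ 2 = x ^ 2 - 1 \<longrightarrow>
           subst_uv s x ((D ^^ n) (var_u * var_v)) =
             fact n * s ^ (n + 1) * poly (chebyshev_T (n + 1)) x \<and>
           subst_uv s x ((D ^^ n) (var_u ^ 2)) =
             fact n * s ^ (n + 2) * poly (chebyshev_U n) x)"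
proof (intro conjI allI impI)
  note uv = formal_derivative_iterate_uv[OF assms, of n]
  note u2 = formal_derivative_iterate_u2[OF assms, of n]
  \<comment> \<open>Cancelling 2 is sound because \<open>poly_uv\<close> is an integral domain of
    characteristic 0.\<close>
  have two: "p = q" if "2 * p = 2 * q" for p q :: poly_uv
    using that by simp
  show "(D ^^ n) (var_u * var_v) = fact n * (\<Sum>k = 0..(n + 1) div 2.
      of_nat ((n + 1) choose (2 * k)) * var_u ^ (n + 1 + 2 * k) * var_v ^ (n + 1 - 2 * k))"
    by (rule two, unfold uv binomial_even_part)
      (simp only: sum_distrib_left power_add mult_ac)
  show "(D ^^ n) (var_u ^ 2) = fact n * (\<Sum>k = 0..n div 2.
      of_nat ((n + 1) choose (2 * k + 1)) * var_u ^ (n + 2 + 2 * k) * var_v ^ (n - 2 * k))"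
    by (rule two, unfold u2 binomial_odd_part)
      (simp only: sum_distrib_left power_add mult_ac power2_eq_square power_one_right)
  fix x s :: 'a
  assume s: "s ^ 2 = x ^ 2 - 1"
  note subst = subst_uv_simps subst_uv_diff subst_uv_power subst_uv_fact subst_uv_2
  \<comment> \<open>Substitution respects sums, differences and products, so it turns the closed
    form in u, v into the same expression in \<open>s\<close>, \<open>x\<close>.\<close>
  have "2 * subst_uv s x ((D ^^ n) (var_u * var_v)) =
      fact n * s ^ (n + 1) * (2 * poly (chebyshev_T (n + 1)) x)"
    using arg_cong[OF uv, of "subst_uv s x"]
    by (simp only: subst chebyshev_T_power_sum[OF s])
  then show "subst_uv s x ((D ^^ n) (var_u * var_v)) =
      fact n * s ^ (n + 1) * poly (chebyshev_T (n + 1)) x"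
    by (simp del: chebyshev_T.simps)
  \<comment> \<open>The extra \<open>s\<close> contributed by \<open>chebyshev_U_power_diff\<close>
    raises the final exponent from \<open>n + 1\<close> to \<open>n + 2\<close>.\<close>
  have "2 * subst_uv s x ((D ^^ n) (var_u ^ 2)) =
      fact n * s ^ (n + 1) * (2 * s * poly (chebyshev_U n) x)"
    using arg_cong[OF u2, of "subst_uv s x"]
    by (simp only: subst chebyshev_U_power_diff[OF s])
  then show "subst_uv s x ((D ^^ n) (var_u ^ 2)) =
      fact n * s ^ (n + 2) * poly (chebyshev_U n) x"
    by simp
qed

end
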